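(* A ring $R$ is GUNC if and only if all of the following three conditions hold: (i) $\mathrm{Nil}(R)$ is an ideal of $R$; (ii) $R/\mathrm{Nil}(R)$ is either a boolean ring or a division ring; (iii) $R$ is an abelian ring.
   Context: Rings are associative with identity, not necessarily commutative. $\mathrm{Nil}(R)$ is the set of nilpotent elements of $R$. A ring is abelian if each of its idempotents is central, and boolean if every element is an idempotent. An element $a\in R$ is uniquely nil-clean if there is a unique idempotent $e\in R$ such that $a-e$ is nilpotent. The ring $R$ is generalized uniquely nil-clean (GUNC) if every non-invertible element of $R$ is uniquely nil-clean. *)

theory Defs
  imports "HOL-Algebra.QuotRing"
begin

definition nilpotents :: "('a, 'm) ring_scheme \<Rightarrow> 'a set"
  where "nilpotents R =
    {x \<in> carrier R. \<exists>n::nat. n > 0 \<and> x [^]\<^bsub>R\<^esub> n = \<zero>\<^bsub>R\<^esub>}"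

definition idempotents :: "('a, 'm) ring_scheme \<Rightarrow> 'a set"
  where "idempotents R = {e \<in> carrier R. e \<otimes>\<^bsub>R\<^esub> e = e}"

definition uniquely_nil_clean :: "('a, 'm) ring_scheme \<Rightarrow> 'a \<Rightarrow> bool"
  where "uniquely_nil_clean R a \<longleftrightarrow>
    (\<exists>!e. e \<in> idempotents R \<and> a \<ominus>\<^bsub>R\<^esub> e \<in> nilpotents R)"

locale gunc_ring = ring R for R (structure) +
  assumes nonunit_uniquely_nil_clean:
    "\<lbrakk>a \<in> carrier R; a \<notin> Units R\<rbrakk> \<Longrightarrow> uniquely_nil_clean R a"

text \<open>
  ``Abelian'' refers to central idempotents. This is unrelated to commutativity of multiplication
  and to the library locale \<^locale>\<open>abelian_group\<close>.
\<close>

locale abelian_ring = ring R for R (structure) +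
  assumes idempotent_central:
    "\<lbrakk>e \<in> idempotents R; x \<in> carrier R\<rbrakk> \<Longrightarrow> e \<otimes> x = x \<otimes> e"

text \<open>The zero ring is boolean.\<close>

locale boolean_ring = ring R for R (structure) +
  assumes all_idempotent: "carrier R \<subseteq> idempotents R"

text \<open>
  A division ring in the usual sense, possibly noncommutative; the name avoids the
  type class \<^class>\<open>division_ring\<close>.
\<close>

locale skew_field = ring R for R (structure) +
  assumes one_neq_zero: "\<one> \<noteq> \<zero>"
    and nonzero_Units: "Units R = carrier R - {\<zero>}"

end

theory Submission
  imports Defs "HOL-Algebra.Multiplicative_Group"
begin

text \<open>
  In a GUNC ring, an idempotent \<open>e\<close> and the idempotent \<open>e + e r (1 - e)\<close> differ by a nilpotent, so
  uniqueness forces \<open>e r (1 - e) = 0\<close>; idempotents are therefore central. A unit, as well as a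
  sum \<open>a = e + n\<close> of an idempotent and a nilpotent, is left invertible in some corner \<open>e R\<close>, where
  \<open>e = 0\<close> only for nilpotent \<open>a\<close>. Since a nilpotent is left invertible in no nonzero corner, products
  \<open>r x\<close> and sums \<open>x + y\<close> of nilpotents \<open>x\<close>, \<open>y\<close> are nilpotent. If a nontrivial idempotent \<open>e\<close> exists,
  \<open>e a\<close> and \<open>(1 - e) a\<close> are nonunits, hence idempotent modulo nilpotents, and so is their sum \<open>a\<close>;
  otherwise every nonunit is nilpotent.

  Conversely, idempotents lift modulo the nil ideal, they lift uniquely because they are central,
  and an element is a unit as soon as its class modulo the nil ideal is a unit.
\<close>

section \<open>Membership rules for nilpotents and idempotents\<close>

lemma nilpotentsI:
  "x \<in> carrier R \<Longrightarrow> x [^]\<^bsub>R\<^esub> (n::nat) = \<zero>\<^bsub>R\<^esub> \<Longrightarrow> n > 0 \<Longrightarrow> x \<in> nilpotents R"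
  unfolding nilpotents_def by blast

lemma nilpotents_carrier [simp]: "x \<in> nilpotents R \<Longrightarrow> x \<in> carrier R"
  unfolding nilpotents_def by blast

lemma idempotents_carrier [simp]: "e \<in> idempotents R \<Longrightarrow> e \<in> carrier R"
  unfolding idempotents_def by blast

lemma idempotents_idem [simp]: "e \<in> idempotents R \<Longrightarrow> e \<otimes>\<^bsub>R\<^esub> e = e"
  unfolding idempotents_def by blast

lemma idempotentsI: "e \<in> carrier R \<Longrightarrow> e \<otimes>\<^bsub>R\<^esub> e = e \<Longrightarrow> e \<in> idempotents R"
  unfolding idempotents_def by blast

section \<open>Nilpotents, units and idempotents in an arbitrary ring\<close>

context ring
begin

text \<open>The factor is the geometric sum of \<open>(1 - x)^i\<close> over \<open>i < n\<close>.
  As a polynomial in \<open>x\<close> it commutes with whatever commutes with \<open>x\<close>; this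
  later makes inverses two-sided and lets powers of \<open>x g\<close> split.\<close>

lemma one_minus_pow_factor:
  assumes "x \<in> carrier R"
  shows "\<exists>g\<in>carrier R. \<one> \<ominus> (\<one> \<ominus> x) [^] (n::nat) = x \<otimes> g \<and>
    (\<forall>y\<in>carrier R. x \<otimes> y = y \<otimes> x \<longrightarrow> g \<otimes> y = y \<otimes> g)"
proof (induction n)
  case 0
  show ?case using assms by (intro bexI[of _ \<zero>]) (auto simp: minus_eq r_neg)
next
  case (Suc n)
  then obtain g where g: "g \<in> carrier R" "\<one> \<ominus> (\<one> \<ominus> x) [^] n = x \<otimes> g"
    "\<And>y. y \<in> carrier R \<Longrightarrow> x \<otimes> y = y \<otimes> x \<Longrightarrow> g \<otimes> y = y \<otimes> g"
    by blast
  define p where "p = (\<one> \<ominus> x) [^] n"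
  have p: "p \<in> carrier R" using assms by (simp add: p_def)
  have p_comm: "p \<otimes> y = y \<otimes> p" if y: "y \<in> carrier R" "x \<otimes> y = y \<otimes> x" for y
  proof -
    have "(\<one> \<ominus> x) \<otimes> y = y \<otimes> (\<one> \<ominus> x)"
      using assms y by (simp add: minus_eq l_distr r_distr l_minus r_minus)
    then show ?thesis using assms y by (simp add: p_def group_commutes_pow)
  qed
  have "\<one> \<ominus> (\<one> \<ominus> x) [^] Suc n = \<one> \<ominus> p \<otimes> (\<one> \<ominus> x)"
    by (simp add: p_def)
  also have "\<dots> = (\<one> \<ominus> p) \<oplus> p \<otimes> x" using assms p by algebra simp
  also have "\<dots> = x \<otimes> g \<oplus> x \<otimes> p"
    using g(2) p_comm[of x] assms by (simp add: p_def)
  also have "\<dots> = x \<otimes> (g \<oplus> p)" using assms g p by (simp add: r_distr)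
  finally show ?case
    using assms g p p_comm by (intro bexI[of _ "g \<oplus> p"]) (auto simp: l_distr r_distr)
qed

text \<open>With \<open>1 - x\<close> in place of \<open>x\<close>, the factorization reads
  \<open>1 - x^n = (1 - x) g\<close>, and \<open>g\<close> commutes with
  \<open>1 - x\<close>.\<close>

lemma Units_one_minus_nilpotent:
  assumes "x \<in> nilpotents R"
  shows "\<one> \<ominus> x \<in> Units R"
proof -
  from assms obtain n :: nat where x: "x \<in> carrier R" and n: "n > 0" "x [^] n = \<zero>"
    unfolding nilpotents_def by blast
  obtain g where g: "g \<in> carrier R" "\<one> \<ominus> (\<one> \<ominus> (\<one> \<ominus> x)) [^] n = (\<one> \<ominus> x) \<otimes> g"
    "(\<one> \<ominus> x) \<otimes> (\<one> \<ominus> x) = (\<one> \<ominus> x) \<otimes> (\<one> \<ominus> x) \<longrightarrow> g \<otimes> (\<one> \<ominus> x) = (\<one> \<ominus> x) \<otimes> g"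
    using one_minus_pow_factor[of "\<one> \<ominus> x" n] x by blast
  moreover have "\<one> \<ominus> (\<one> \<ominus> x) = x" using x by algebra
  ultimately have "(\<one> \<ominus> x) \<otimes> g = \<one>" "g \<otimes> (\<one> \<ominus> x) = \<one>"
    using n by (simp_all add: minus_eq)
  then show ?thesis using x g(1) unfolding Units_def by blast
qed

lemma nilpotent_minus:
  assumes "x \<in> nilpotents R"
  shows "\<ominus> x \<in> nilpotents R"
proof -
  from assms obtain n :: nat where x: "x \<in> carrier R" and n: "n > 0" "x [^] n = \<zero>"
    unfolding nilpotents_def by blast
  have "\<ominus> x = \<ominus> \<one> \<otimes> x" using x by (simp add: l_minus)
  then have "(\<ominus> x) [^] n = \<zero>"
    using x n pow_mult_distrib[of "\<ominus> \<one>" x n] by (simp add: l_minus r_minus)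
  then show ?thesis using x n by (auto intro: nilpotentsI)
qed

lemma Units_one_plus_nilpotent:
  assumes "x \<in> nilpotents R"
  shows "\<one> \<oplus> x \<in> Units R"
  using Units_one_minus_nilpotent[OF nilpotent_minus[OF assms]] assms by (simp add: minus_eq)

lemma zero_nilpotent: "\<zero> \<in> nilpotents R"
  by (rule nilpotentsI[of _ _ 1]) auto

text \<open>Rebracketing gives \<open>(y x)^(k+1) = y (x y)^k x\<close>, so one extra factor
  suffices. This carries closure under left multiples over to right multiples.\<close>

lemma nilpotent_mult_swap:
  assumes x: "x \<in> carrier R" and y: "y \<in> carrier R" and "x \<otimes> y \<in> nilpotents R"
  shows "y \<otimes> x \<in> nilpotents R"
proof -
  from assms obtain n :: nat where n: "(x \<otimes> y) [^] n = \<zero>"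
    unfolding nilpotents_def by blast
  have "(y \<otimes> x) [^] Suc k = y \<otimes> (x \<otimes> y) [^] k \<otimes> x" for k :: nat
  proof (induction k)
    case (Suc k)
    have "(y \<otimes> x) [^] Suc (Suc k) = (y \<otimes> (x \<otimes> y) [^] k \<otimes> x) \<otimes> (y \<otimes> x)"
      using Suc x y by simp
    also have "\<dots> = y \<otimes> (x \<otimes> y) [^] Suc k \<otimes> x"
      using x y by (simp add: m_assoc)
    finally show ?case .
  qed (use x y in simp)
  then have "(y \<otimes> x) [^] Suc n = \<zero>" using n x y by (simp del: nat_pow_Suc)
  then show ?thesis using x y by (intro nilpotentsI[of _ _ "Suc n"]) (simp_all del: nat_pow_Suc)
qed

lemma idempotent_pow:
  assumes "e \<in> idempotents R" "n > 0"
  shows "e [^] (n::nat) = e"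
  using assms(2)
proof (induction n rule: nat_induct_non_zero)
  case 1
  show ?case using assms by simp
qed (use assms in simp)

lemma nilpotent_idempotent_eq_zero:
  "e \<in> idempotents R \<Longrightarrow> e \<in> nilpotents R \<Longrightarrow> e = \<zero>"
  using idempotent_pow unfolding nilpotents_def by fastforce

lemma one_minus_idempotent:
  assumes "e \<in> idempotents R"
  shows "\<one> \<ominus> e \<in> idempotents R"
proof -
  have e: "e \<in> carrier R" "e \<otimes> e = e" using assms by auto
  have "(\<one> \<ominus> e) \<otimes> (\<one> \<ominus> e) = \<one> \<ominus> e \<ominus> e \<oplus> e \<otimes> e"
    using e(1) by algebra simp
  also have "\<dots> = \<one> \<ominus> e" unfolding e(2) using e(1) by algebra
  finally show ?thesis using e by (auto intro: idempotentsI)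
qed

text \<open>If \<open>e x w = 1\<close>, then \<open>e = e (e x w) = e x w = 1\<close>. Hence, for
  an idempotent \<open>e\<close> other than 1, all of \<open>e R\<close> consists of nonunits, to
  which the GUNC hypothesis applies.\<close>

lemma idempotent_Units_eq_one:
  assumes "e \<in> idempotents R" "x \<in> carrier R" "e \<otimes> x \<in> Units R"
  shows "e = \<one>"
proof -
  let ?w = "inv (e \<otimes> x)"
  have e: "e \<in> carrier R" using assms by simp
  have "e = e \<otimes> ((e \<otimes> x) \<otimes> ?w)" using assms e by simp
  also have "\<dots> = (e \<otimes> e) \<otimes> x \<otimes> ?w" using assms e by (simp add: m_assoc del: Units_r_inv idempotents_idem)
  also have "\<dots> = \<one>" using assms by simp
  finally show ?thesis .
qed

section \<open>Conditions on the quotient expressed by elements of \<open>R\<close>\<close>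

lemma boolean_ring_quotient_iff:
  assumes "ideal I R"
  shows "boolean_ring (R Quot I) \<longleftrightarrow> (\<forall>a\<in>carrier R. a \<otimes> a \<ominus> a \<in> I)"
proof -
  interpret ideal I R by fact
  have "boolean_ring (R Quot I) \<longleftrightarrow> (\<forall>a\<in>carrier R. I +> a \<otimes> a = I +> a)"
  proof -
    have "carrier (R Quot I) = (\<lambda>x. I +> x) ` carrier R"
      by (auto simp: FactRing_simps)
    moreover have "(I +> a) \<otimes>\<^bsub>R Quot I\<^esub> (I +> a) = I +> a \<otimes> a" if "a \<in> carrier R" for a
      using that by (simp add: FactRing_def rcoset_mult_add)
    ultimately show ?thesis
      using quotient_is_ring
      by (simp add: boolean_ring_def boolean_ring_axioms_def idempotents_def subset_eq
          del: idempotents_idem idempotents_carrier)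
  qed
  then show ?thesis by (simp add: quotient_eq_iff_same_a_r_cos[OF assms])
qed

text \<open>An element congruent to 1 is 1 plus a nilpotent, hence a unit; so an inverse modulo the
  nil ideal can be corrected to a true inverse.\<close>

lemma Units_quotient_nilpotents_iff:
  assumes "ideal (nilpotents R) R" and x: "x \<in> carrier R"
  shows "nilpotents R +> x \<in> Units (R Quot nilpotents R) \<longleftrightarrow> x \<in> Units R"
proof -
  let ?N = "nilpotents R"
  interpret ideal ?N R by fact
  have lift: "u \<in> Units R" if u: "u \<in> carrier R" and "?N +> u = ?N +> \<one>" for u
  proof -
    have "u \<ominus> \<one> \<in> ?N"
      using that quotient_eq_iff_same_a_r_cos[OF assms(1), of u \<one>] by simp
    then have "\<one> \<oplus> (u \<ominus> \<one>) \<in> Units R" by (rule Units_one_plus_nilpotent)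
    moreover have "\<one> \<oplus> (u \<ominus> \<one>) = u" using u by algebra
    ultimately show ?thesis by simp
  qed
  have *: "?N +> x \<in> Units (R Quot ?N) \<longleftrightarrow>
      (\<exists>y\<in>carrier R. ?N +> y \<otimes> x = ?N +> \<one> \<and> ?N +> x \<otimes> y = ?N +> \<one>)"
    using x by (auto simp: Units_def FactRing_simps rcoset_mult_add)
  show ?thesis
  proof
    assume "?N +> x \<in> Units (R Quot ?N)"
    then obtain y where y: "y \<in> carrier R" "y \<otimes> x \<in> Units R" "x \<otimes> y \<in> Units R"
      using * lift x by auto
    \<comment> \<open>Without commutativity, \<open>y x\<close> and \<open>x y\<close> are corrected
      separately, giving a left and a right inverse of \<open>x\<close>, which then
      coincide.\<close>
    let ?l = "inv (y \<otimes> x) \<otimes> y" and ?r = "y \<otimes> inv (x \<otimes> y)"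
    have l: "?l \<otimes> x = \<one>" "?l \<in> carrier R"
      using x y by (simp_all add: m_assoc)
    have r: "x \<otimes> ?r = \<one>" "?r \<in> carrier R"
      using x y by (simp_all flip: m_assoc)
    have "?l = ?r" using inv_unique[OF l(1) r(1) x l(2) r(2)] .
    then show "x \<in> Units R"
      using x l r unfolding Units_def by auto
  next
    assume "x \<in> Units R"
    then show "?N +> x \<in> Units (R Quot ?N)"
      unfolding * by (intro bexI[of _ "inv x"]) auto
  qed
qed

lemma skew_field_quotient_nilpotents_iff:
  assumes "ideal (nilpotents R) R"
  shows "skew_field (R Quot nilpotents R) \<longleftrightarrow>
    \<one> \<noteq> \<zero> \<and> (\<forall>a\<in>carrier R. a \<in> nilpotents R \<or> a \<in> Units R)"
proof -
  let ?N = "nilpotents R" and ?Q = "R Quot nilpotents R"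
  interpret ideal ?N R by fact
  have zero_iff: "?N +> x = \<zero>\<^bsub>?Q\<^esub> \<longleftrightarrow> x \<in> ?N" if "x \<in> carrier R" for x
    using that quotient_eq_iff_same_a_r_cos[OF assms that, of \<zero>] a_subset
    by (simp add: FactRing_def minus_eq)
  have "\<one> \<in> ?N \<longleftrightarrow> \<one> = \<zero>"
    using zero_nilpotent unfolding nilpotents_def by force
  then have one_iff: "\<one>\<^bsub>?Q\<^esub> = \<zero>\<^bsub>?Q\<^esub> \<longleftrightarrow> \<one> = \<zero>"
    using zero_iff[of \<one>] by (simp add: FactRing_def)
  have carr: "carrier ?Q = (\<lambda>x. ?N +> x) ` carrier R"
    by (auto simp: FactRing_simps)
  have "Units ?Q = carrier ?Q - {\<zero>\<^bsub>?Q\<^esub>} \<longleftrightarrow>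
      (\<forall>a\<in>carrier R. a \<in> Units R \<longleftrightarrow> a \<notin> ?N)"
  proof -
    have "Units ?Q \<subseteq> carrier ?Q" by (auto simp: Units_def)
    then have "Units ?Q = carrier ?Q - {\<zero>\<^bsub>?Q\<^esub>} \<longleftrightarrow>
        (\<forall>q\<in>carrier ?Q. q \<in> Units ?Q \<longleftrightarrow> q \<noteq> \<zero>\<^bsub>?Q\<^esub>)" by blast
    then show ?thesis
      by (simp add: carr zero_iff Units_quotient_nilpotents_iff[OF assms])
  qed
  \<comment> \<open>The disjunction yields only that non-nilpotents are units. Conversely, a
    nilpotent unit would put 1 into the ideal, and 1 is nilpotent only in the zero ring.\<close>
  moreover have "a \<notin> ?N" if "a \<in> Units R" "\<one> \<noteq> \<zero>" for a
  proof
    assume "a \<in> ?N"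
    then have "\<one> \<in> ?N" using I_l_closed[of a "inv a"] that by simp
    then show False using that \<open>\<one> \<in> ?N \<longleftrightarrow> \<one> = \<zero>\<close> by simp
  qed
  ultimately show ?thesis
    using quotient_is_ring one_iff unfolding skew_field_def skew_field_axioms_def by blast
qed

end

section \<open>Nilpotents and idempotents when idempotents are central\<close>

context abelian_ring
begin

text \<open>In \<open>s^k x^k e\<close> the central \<open>e\<close> moves next to the innermost
  \<open>s x\<close> and absorbs it, so by induction the product equals \<open>e\<close> for all
  \<open>k\<close>, even if \<open>s\<close> and \<open>x\<close> do not commute. At an exponent
  killing \<open>x\<close> it is zero.\<close>

lemma left_invertible_corner_nilpotent:
  assumes e: "e \<in> idempotents R" and s: "s \<in> carrier R" and x: "x \<in> nilpotents R"
    and eq: "s \<otimes> x \<otimes> e = e"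
  shows "e = \<zero>"
proof -
  from x obtain n :: nat where xc: "x \<in> carrier R" and n: "x [^] n = \<zero>"
    unfolding nilpotents_def by blast
  have ec: "e \<in> carrier R" using e by simp
  have "s [^] k \<otimes> x [^] k \<otimes> e = e" for k :: nat
  proof (induction k)
    case 0
    show ?case using ec by simp
  next
    case (Suc k)
    have "s [^] Suc k \<otimes> x [^] Suc k \<otimes> e = s [^] k \<otimes> (s \<otimes> x) \<otimes> (x [^] k \<otimes> e)"
      using s xc ec nat_pow_Suc2[OF xc, of k] by (simp add: m_assoc del: nat_pow_Suc)
    also have "\<dots> = s [^] k \<otimes> (s \<otimes> x \<otimes> e) \<otimes> x [^] k"
      using s xc ec idempotent_central[OF e, of "x [^] k"] by (simp add: m_assoc)
    also have "\<dots> = s [^] k \<otimes> x [^] k \<otimes> e"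
      unfolding eq using s xc ec idempotent_central[OF e, of "x [^] k"] by (simp add: m_assoc)
    finally show ?case using Suc by simp
  qed
  from this[of n] show ?thesis using n s ec by simp
qed

text \<open>The hypothesis reduces nilpotency to the vanishing of a corner: \<open>a\<close> is
  nilpotent once the idempotent \<open>e\<close> on which \<open>b\<close> inverts it from the left
  is zero.\<close>

lemma ideal_nilpotents:
  assumes corner: "\<And>a. a \<in> carrier R \<Longrightarrow>
    \<exists>e\<in>idempotents R. \<exists>b\<in>carrier R. b \<otimes> a \<otimes> e = e \<and> (e = \<zero> \<longrightarrow> a \<in> nilpotents R)"
  shows "ideal (nilpotents R) R"
proof (rule idealI)
  show left: "r \<otimes> x \<in> nilpotents R" if x: "x \<in> nilpotents R" and r: "r \<in> carrier R" for x r
  proof -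
    obtain e b where e: "e \<in> idempotents R" and b: "b \<in> carrier R" "b \<otimes> (r \<otimes> x) \<otimes> e = e"
      and "e = \<zero> \<longrightarrow> r \<otimes> x \<in> nilpotents R"
      using corner[of "r \<otimes> x"] x r by auto
    \<comment> \<open>Regrouped as \<open>(b r) x e = e\<close>, the equation makes \<open>x\<close>
      left invertible in the corner.\<close>
    moreover have "e = \<zero>"
      using left_invertible_corner_nilpotent[OF e _ x, of "b \<otimes> r"] b r x e by (simp add: m_assoc)
    ultimately show ?thesis by simp
  qed
  show "x \<otimes> r \<in> nilpotents R" if "x \<in> nilpotents R" "r \<in> carrier R" for x r
    using nilpotent_mult_swap[OF that(2) _ left[OF that]] that by simp
  have add: "x \<oplus> y \<in> nilpotents R" if x: "x \<in> nilpotents R" and y: "y \<in> nilpotents R" for x y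
  proof -
    have xy: "x \<in> carrier R" "y \<in> carrier R" using x y by auto
    obtain e b where e: "e \<in> idempotents R" and b: "b \<in> carrier R" "b \<otimes> (x \<oplus> y) \<otimes> e = e"
      and *: "e = \<zero> \<longrightarrow> x \<oplus> y \<in> nilpotents R"
      using corner[of "x \<oplus> y"] xy by auto
    have ec: "e \<in> carrier R" using e by simp
    \<comment> \<open>Since \<open>b x\<close> is nilpotent, \<open>?u\<close> is a unit. From
      \<open>b (x + y) e = e\<close> follows \<open>b y e = ?u e\<close>, so
      \<open>inv ?u \<otimes> b\<close> inverts \<open>y\<close> from the left in the
      corner.\<close>
    let ?u = "\<one> \<ominus> b \<otimes> x"
    have u: "?u \<in> Units R" using left[OF x b(1)] by (rule Units_one_minus_nilpotent)
    have "b \<otimes> y \<otimes> e = b \<otimes> (x \<oplus> y) \<otimes> e \<ominus> b \<otimes> x \<otimes> e"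
      using b(1) xy ec by algebra
    also have "\<dots> = ?u \<otimes> e" unfolding b(2) using b(1) xy ec by algebra
    finally have "inv ?u \<otimes> b \<otimes> y \<otimes> e = inv ?u \<otimes> (?u \<otimes> e)"
      using u b(1) xy ec by (simp add: m_assoc)
    also have "\<dots> = e" using u ec by (simp flip: m_assoc add: Units_closed)
    finally have "e = \<zero>"
      using left_invertible_corner_nilpotent[OF e _ y, of "inv ?u \<otimes> b"] u b(1) by simp
    with * show ?thesis by simp
  qed
  show "subgroup (nilpotents R) (add_monoid R)"
    by (rule add.subgroupI) (use zero_nilpotent nilpotent_minus add in \<open>auto simp: a_inv_def\<close>)
qed (rule ring_axioms)

text \<open>The product \<open>x (1 - y) = x (x - y)\<close> lies in the ideal, and centrality makes
  it idempotent, so it is zero and \<open>x = x y\<close>. By symmetry the two idempotents absorb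
  each other; as they commute, they agree.\<close>

lemma idempotent_eqI:
  assumes "ideal (nilpotents R) R" and e: "e \<in> idempotents R" and f: "f \<in> idempotents R"
    and ef: "e \<ominus> f \<in> nilpotents R"
  shows "e = f"
proof -
  interpret ideal "nilpotents R" R by fact
  have absorb: "x = x \<otimes> y" if x: "x \<in> idempotents R" and y: "y \<in> idempotents R"
    and xy: "x \<ominus> y \<in> nilpotents R" for x y
  proof -
    have xc: "x \<in> carrier R" "y \<in> carrier R" using x y by auto
    let ?z = "\<one> \<ominus> y"
    have z: "?z \<in> idempotents R" using y by (rule one_minus_idempotent)
    have "x \<otimes> ?z = x \<otimes> x \<ominus> x \<otimes> y" using x xc by (simp add: minus_eq r_distr r_minus)
    also have "\<dots> = x \<otimes> (x \<ominus> y)" using xc by algebra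
    finally have "x \<otimes> ?z \<in> nilpotents R" using xy xc by (simp add: I_l_closed)
    moreover have "x \<otimes> ?z \<in> idempotents R"
    proof -
      have "(x \<otimes> ?z) \<otimes> (x \<otimes> ?z) = x \<otimes> (?z \<otimes> x) \<otimes> ?z" using xc by (simp add: m_assoc)
      also have "?z \<otimes> x = x \<otimes> ?z" using idempotent_central[OF x, of ?z] xc by simp
      also have "x \<otimes> (x \<otimes> ?z) \<otimes> ?z = (x \<otimes> x) \<otimes> (?z \<otimes> ?z)"
        using xc by (simp add: m_assoc del: idempotents_idem)
      also have "\<dots> = x \<otimes> ?z" using x z by simp
      finally show ?thesis using xc by (intro idempotentsI) auto
    qed
    ultimately have "x \<otimes> ?z = \<zero>" using nilpotent_idempotent_eq_zero by blast
    then have "x \<ominus> x \<otimes> y = \<zero>" using xc by (simp add: minus_eq r_distr r_minus)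
    then show ?thesis using xc by simp
  qed
  have "f \<ominus> e \<in> nilpotents R"
  proof -
    have "f \<ominus> e = \<ominus> (e \<ominus> f)" using idempotents_carrier[OF e] idempotents_carrier[OF f] by algebra
    then show ?thesis using nilpotent_minus[OF ef] by simp
  qed
  then have "f = f \<otimes> e" using absorb f e by blast
  moreover have "e = e \<otimes> f" using absorb e f ef by blast
  ultimately show ?thesis using idempotent_central[OF e, of f] f by simp
qed

end

text \<open>
  The lift is \<open>e = (1 - (1 - a)\<^sup>n)\<^sup>n\<close> with \<open>(a (1 - a))\<^sup>n = 0\<close>: it is divisible by \<open>a\<^sup>n\<close> and
  \<open>1 - e\<close> is divisible by \<open>(1 - a)\<^sup>n\<close>, so \<open>e (1 - e) = 0\<close>.
\<close>

lemma (in ring) idempotent_lift: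
  assumes "ideal (nilpotents R) R" and sq: "\<And>x. x \<in> carrier R \<Longrightarrow> x \<otimes> x \<ominus> x \<in> nilpotents R"
    and a: "a \<in> carrier R"
  shows "\<exists>e\<in>idempotents R. a \<ominus> e \<in> nilpotents R"
proof -
  interpret ideal "nilpotents R" R by fact
  \<comment> \<open>Modulo the ideal every element is idempotent, hence equal to each of its
    positive powers.\<close>
  have pow: "x \<ominus> x [^] n \<in> nilpotents R" if x: "x \<in> carrier R" and "n > 0" for x and n :: nat
    using that(2)
  proof (induction n rule: nat_induct_non_zero)
    case 1
    show ?case using x zero_nilpotent by (simp add: minus_eq r_neg)
  next
    case (Suc n)
    have "x \<ominus> x [^] Suc n = (x \<ominus> x [^] n) \<otimes> x \<oplus> \<ominus> (x \<otimes> x \<ominus> x)"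
    proof -
      have "x \<ominus> p \<otimes> x = (x \<ominus> p) \<otimes> x \<oplus> \<ominus> (x \<otimes> x \<ominus> x)" if "p \<in> carrier R" for p
        using x that by algebra
      then show ?thesis using x by simp
    qed
    then show ?case using Suc x sq[OF x] by (simp add: I_r_closed del: nat_pow_Suc)
  qed
  have "a \<otimes> (\<one> \<ominus> a) \<in> nilpotents R"
  proof -
    have "a \<otimes> (\<one> \<ominus> a) = \<ominus> (a \<otimes> a \<ominus> a)" using a by algebra simp
    then show ?thesis using sq[OF a] nilpotent_minus by simp
  qed
  then obtain n :: nat where n: "n > 0" "(a \<otimes> (\<one> \<ominus> a)) [^] n = \<zero>"
    unfolding nilpotents_def by blast
  let ?b = "\<one> \<ominus> a"
  let ?c = "?b [^] n"
  let ?e = "(\<one> \<ominus> ?c) [^] n"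
  have ab: "a \<otimes> ?b = ?b \<otimes> a" using a by algebra simp
  have c: "?c \<in> carrier R" using a by simp
  obtain g where g: "g \<in> carrier R" "\<one> \<ominus> ?c = a \<otimes> g" "g \<otimes> a = a \<otimes> g"
    using one_minus_pow_factor[OF a, of n] a by blast
  obtain h where h: "h \<in> carrier R" "\<one> \<ominus> ?e = ?c \<otimes> h"
    using one_minus_pow_factor[OF c, of n] by blast
  have e: "?e \<in> carrier R" using c by simp
  \<comment> \<open>As \<open>g\<close> commutes with \<open>a\<close>, the power of
    \<open>a g\<close> splits with \<open>a^n\<close> on the right, next to \<open>?c\<close>, where
    \<open>a^n (1 - a)^n = (a (1 - a))^n = 0\<close>.\<close>
  have "?e = g [^] n \<otimes> a [^] n"
    using pow_mult_distrib[OF g(3,1) a, of n] g(2,3) by simp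
  then have "?e \<otimes> (\<one> \<ominus> ?e) = g [^] n \<otimes> (a [^] n \<otimes> ?c) \<otimes> h"
    unfolding h(2) using g(1) a h(1) by (simp add: m_assoc)
  also have "\<dots> = \<zero>"
    using n(2) a g(1) h(1) pow_mult_distrib[OF ab, of n] by simp
  finally have "?e \<ominus> ?e \<otimes> ?e = \<zero>" using e by (simp add: minus_eq r_distr r_minus)
  then have "?e \<in> idempotents R" using e by (intro idempotentsI) auto
  moreover have "a \<ominus> ?e \<in> nilpotents R"
  proof -
    \<comment> \<open>Both brackets have the form \<open>x - x^n\<close>, first for
      \<open>1 - a\<close>, then for \<open>1 - ?c\<close>.\<close>
    have "a \<ominus> ?e = \<ominus> (?b \<ominus> ?c) \<oplus> ((\<one> \<ominus> ?c) \<ominus> ?e)"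
      using a c e by algebra
    then show ?thesis using pow[of ?b n] pow[of "\<one> \<ominus> ?c" n] a c n by simp
  qed
  ultimately show ?thesis by blast
qed

section \<open>Consequences of the GUNC condition\<close>

context gunc_ring
begin

lemma nonunit_decompose:
  assumes "a \<in> carrier R" "a \<notin> Units R"
  obtains e where "e \<in> idempotents R" "a \<ominus> e \<in> nilpotents R"
  using nonunit_uniquely_nil_clean[OF assms] unfolding uniquely_nil_clean_def by blast

text \<open>For a nonunit \<open>e\<close>, both \<open>e + 0\<close> and \<open>f + (e - f)\<close>
  are nil-clean decompositions of \<open>e\<close>, so uniqueness applies. A unit \<open>e\<close>
  is 1; then \<open>f = 1 - (1 - f)\<close> is an invertible idempotent as well, hence 1.\<close>

lemma nilpotent_difference_eq:
  assumes e: "e \<in> idempotents R" and f: "f \<in> idempotents R" and "e \<ominus> f \<in> nilpotents R"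
  shows "e = f"
proof (cases "e \<in> Units R")
  case True
  then have "e = \<one>" using idempotent_Units_eq_one[OF e, of \<one>] e by simp
  moreover have "\<one> \<ominus> (\<one> \<ominus> f) = f" using idempotents_carrier[OF f] by algebra
  ultimately have "f \<in> Units R" using Units_one_minus_nilpotent[OF assms(3)] by simp
  then have "f = \<one>" using idempotent_Units_eq_one[OF f, of \<one>] f by simp
  with \<open>e = \<one>\<close> show ?thesis by simp
next
  case False
  have "e \<ominus> e \<in> nilpotents R" using e zero_nilpotent by (simp add: minus_eq r_neg)
  then show ?thesis
    using nonunit_uniquely_nil_clean[OF _ False] e f assms(3) unfolding uniquely_nil_clean_def by auto
qed

sublocale abelian_ring R
proof
  fix e x assume e: "e \<in> idempotents R" and x: "x \<in> carrier R"
  have ec: "e \<in> carrier R" "e \<otimes> e = e" using e by auto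
  \<comment> \<open>The conditions make \<open>e + z\<close> an idempotent that differs from
    \<open>e\<close> by a nilpotent. They cover both off-diagonal Peirce components of
    \<open>x\<close>: \<open>e x (1 - e)\<close> and \<open>(1 - e) x e\<close>, called
    \<open>u\<close> and \<open>v\<close> below.\<close>
  have eq: "z = \<zero>" if z: "z \<in> carrier R" "e \<otimes> z \<oplus> z \<otimes> e = z"
    and sq: "z \<otimes> z = \<zero>" for z
  proof -
    have "(e \<oplus> z) \<otimes> (e \<oplus> z) = e \<otimes> e \<oplus> (e \<otimes> z \<oplus> z \<otimes> e) \<oplus> z \<otimes> z"
      using ec(1) z(1) by algebra
    also have "\<dots> = e \<oplus> z" using ec z sq by simp
    finally have f: "e \<oplus> z \<in> idempotents R" using ec(1) z(1) by (auto intro: idempotentsI)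
    have diff: "(e \<oplus> z) \<ominus> e = z" using ec(1) z(1) by algebra
    have "z \<in> nilpotents R"
      using z sq by (intro nilpotentsI[of _ _ 2]) (auto simp: numeral_2_eq_2)
    then have "e \<oplus> z = e" using nilpotent_difference_eq[OF f e] diff by simp
    then have "z = e \<ominus> e" using diff by simp
    then show ?thesis using ec by (simp add: minus_eq r_neg)
  qed
  have e2: "e \<otimes> (e \<otimes> y) = e \<otimes> y" if "y \<in> carrier R" for y
    using ec that by (simp flip: m_assoc)
  have zero_u: "u = \<zero>" if u: "u = e \<otimes> x \<ominus> e \<otimes> x \<otimes> e" for u
  proof (rule eq)
    show uc: "u \<in> carrier R" using ec x u by simp
    have eu: "e \<otimes> u = u" using ec x e2 u by (simp add: minus_eq r_distr r_minus m_assoc)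
    have ue: "u \<otimes> e = \<zero>" using ec x u by (simp add: minus_eq l_distr l_minus r_neg m_assoc)
    show "e \<otimes> u \<oplus> u \<otimes> e = u" using eu ue uc by simp
    have "u \<otimes> u = (u \<otimes> e) \<otimes> u" using uc ec by (simp add: m_assoc eu)
    then show "u \<otimes> u = \<zero>" using ue uc by simp
  qed
  have zero_v: "v = \<zero>" if v: "v = x \<otimes> e \<ominus> e \<otimes> x \<otimes> e" for v
  proof (rule eq)
    show vc: "v \<in> carrier R" using ec x v by simp
    have ve: "v \<otimes> e = v" using ec x v by (simp add: minus_eq l_distr l_minus m_assoc)
    have ev: "e \<otimes> v = \<zero>" using ec x e2 v by (simp add: minus_eq r_distr r_minus r_neg m_assoc)
    show "e \<otimes> v \<oplus> v \<otimes> e = v" using ve ev vc by simp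
    have "v \<otimes> v = v \<otimes> (e \<otimes> v)" using vc ec by (simp add: ve flip: m_assoc)
    then show "v \<otimes> v = \<zero>" using ev vc by simp
  qed
  have "e \<otimes> x = e \<otimes> x \<otimes> e" using zero_u[OF refl] ec(1) x by simp
  also have "\<dots> = x \<otimes> e" using zero_v[OF refl] ec(1) x by simp
  finally show "e \<otimes> x = x \<otimes> e" .
qed

lemma nilpotents_ideal: "ideal (nilpotents R) R"
proof (rule ideal_nilpotents)
  fix a assume a: "a \<in> carrier R"
  show "\<exists>e\<in>idempotents R. \<exists>b\<in>carrier R. b \<otimes> a \<otimes> e = e \<and> (e = \<zero> \<longrightarrow> a \<in> nilpotents R)"
  proof (cases "a \<in> Units R")
    \<comment> \<open>For a unit the corner is the whole ring; it vanishes only in the zero ring,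
      where everything is nilpotent.\<close>
    case True
    have one: "\<one> \<in> idempotents R" by (auto intro: idempotentsI)
    have "inv a \<otimes> a \<otimes> \<one> = \<one>" using True by simp
    moreover have "a \<in> nilpotents R" if "\<one> = \<zero>"
      using that a zero_nilpotent one_zeroD by auto
    ultimately show ?thesis using one Units_inv_closed[OF True] by blast
  next
    case False
    with a obtain e where e: "e \<in> idempotents R" and n: "a \<ominus> e \<in> nilpotents R"
      by (rule nonunit_decompose)
    have ec: "e \<in> carrier R" "e \<otimes> e = e" using e by auto
    \<comment> \<open>Since \<open>?u e = e + a e - e e = a e\<close>, the unit \<open>?u\<close>
      agrees with \<open>a\<close> on the corner, and its inverse serves as
      \<open>b\<close>.\<close>
    let ?u = "\<one> \<oplus> (a \<ominus> e)"
    have u: "?u \<in> Units R" using n by (rule Units_one_plus_nilpotent)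
    have "?u \<otimes> e = e \<oplus> a \<otimes> e \<ominus> e \<otimes> e" using a ec(1) by algebra
    also have "\<dots> = a \<otimes> e" unfolding ec(2) using a ec(1) by algebra
    finally have "inv ?u \<otimes> a \<otimes> e = inv ?u \<otimes> (?u \<otimes> e)" using u a ec by (simp add: m_assoc)
    also have "\<dots> = e" using u ec by (simp flip: m_assoc add: Units_closed)
    finally have "inv ?u \<otimes> a \<otimes> e = e" .
    moreover have "a \<in> nilpotents R" if "e = \<zero>" using that n a by (simp add: minus_eq)
    moreover have "inv ?u \<in> carrier R" using u by simp
    ultimately show ?thesis using e by blast
  qed
qed

lemma nonunit_sq_minus_nilpotent:
  assumes a: "a \<in> carrier R" "a \<notin> Units R"
  shows "a \<otimes> a \<ominus> a \<in> nilpotents R"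
proof -
  interpret ideal "nilpotents R" R by (rule nilpotents_ideal)
  obtain e where e: "e \<in> idempotents R" and n: "a \<ominus> e \<in> nilpotents R"
    using a by (rule nonunit_decompose)
  have ec: "e \<in> carrier R" "e \<otimes> e = e" using e by auto
  \<comment> \<open>As \<open>a\<close> is congruent to \<open>e\<close>, so is \<open>a a\<close>
    to \<open>e e = e\<close>; this combination of multiples of \<open>a - e\<close> makes it
    explicit.\<close>
  have "a \<otimes> (a \<ominus> e) \<oplus> (a \<ominus> e) \<otimes> e \<oplus> \<ominus> (a \<ominus> e) = a \<otimes> a \<ominus> e \<otimes> e \<ominus> a \<oplus> e"
    using a(1) ec(1) by algebra
  also have "\<dots> = a \<otimes> a \<ominus> a" unfolding ec(2) using a(1) ec(1) by algebra
  finally have "a \<otimes> a \<ominus> a = a \<otimes> (a \<ominus> e) \<oplus> (a \<ominus> e) \<otimes> e \<oplus> \<ominus> (a \<ominus> e)" by (rule sym)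
  moreover have "\<dots> \<in> nilpotents R"
    by (rule a_closed[OF a_closed[OF I_l_closed[OF n a(1)] I_r_closed[OF n ec(1)]] a_inv_closed[OF n]])
  ultimately show ?thesis by (rule ssubst)
qed

lemma quotient_boolean_or_skew:
  "boolean_ring (R Quot nilpotents R) \<or> skew_field (R Quot nilpotents R)"
proof (cases "\<exists>e\<in>idempotents R. e \<noteq> \<zero> \<and> e \<noteq> \<one>")
  interpret ideal "nilpotents R" R by (rule nilpotents_ideal)
  case True
  then obtain e where e: "e \<in> idempotents R" "e \<noteq> \<zero>" "e \<noteq> \<one>" by blast
  \<comment> \<open>Centrality gives \<open>(f a)^2 - f a = f (a^2 - a)\<close>, and
    \<open>f a\<close> is a nonunit because \<open>f\<close> is not 1.\<close>
  have part: "f \<otimes> (a \<otimes> a \<ominus> a) \<in> nilpotents R"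
    if f: "f \<in> idempotents R" "f \<noteq> \<one>" and a: "a \<in> carrier R" for f a
  proof -
    have fc: "f \<in> carrier R" "f \<otimes> f = f" using f by auto
    have "(f \<otimes> a) \<otimes> (f \<otimes> a) = f \<otimes> (a \<otimes> f) \<otimes> a" using fc a by (simp add: m_assoc)
    also have "\<dots> = (f \<otimes> f) \<otimes> (a \<otimes> a)"
      unfolding idempotent_central[OF f(1) a, symmetric] using fc(1) a by (simp add: m_assoc)
    finally have "(f \<otimes> a) \<otimes> (f \<otimes> a) \<ominus> f \<otimes> a = f \<otimes> (a \<otimes> a \<ominus> a)"
      using fc a by (simp add: minus_eq r_distr r_minus)
    moreover have "f \<otimes> a \<notin> Units R" using idempotent_Units_eq_one f a by blast
    ultimately show ?thesis using nonunit_sq_minus_nilpotent[of "f \<otimes> a"] fc a by simp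
  qed
  have "a \<otimes> a \<ominus> a \<in> nilpotents R" if a: "a \<in> carrier R" for a
  proof -
    let ?d = "a \<otimes> a \<ominus> a"
    have ec: "e \<in> carrier R" using e by simp
    \<comment> \<open>\<open>part\<close> is applied to both \<open>e\<close> and
      \<open>1 - e\<close>, so both must differ from 1; here \<open>e \<noteq> \<zero>\<close>
      enters.\<close>
    have "\<one> \<ominus> e \<noteq> \<one>"
    proof
      assume "\<one> \<ominus> e = \<one>"
      moreover have "e = \<one> \<ominus> (\<one> \<ominus> e)" using ec by algebra
      ultimately show False using e by (simp add: minus_eq r_neg)
    qed
    then have "e \<otimes> ?d \<oplus> (\<one> \<ominus> e) \<otimes> ?d \<in> nilpotents R"
      using part[OF _ _ a] e one_minus_idempotent by auto
    moreover have "e \<otimes> ?d \<oplus> (\<one> \<ominus> e) \<otimes> ?d = ?d" using a ec by algebra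
    ultimately show ?thesis by simp
  qed
  then show ?thesis using boolean_ring_quotient_iff[OF nilpotents_ideal] by simp
next
  case False
  have local: "a \<in> nilpotents R" if a: "a \<in> carrier R" "a \<notin> Units R" for a
  proof -
    obtain e where e: "e \<in> idempotents R" and n: "a \<ominus> e \<in> nilpotents R"
      using a by (rule nonunit_decompose)
    have "e \<noteq> \<one>"
    proof
      assume "e = \<one>"
      then have "a = \<one> \<oplus> (a \<ominus> e)" using a(1) by algebra
      then show False using Units_one_plus_nilpotent[OF n] a by simp
    qed
    then have "e = \<zero>" using False e by blast
    then show ?thesis using n a by (simp add: minus_eq)
  qed
  show ?thesis
  proof (cases "\<one> = \<zero>")
    \<comment> \<open>The zero ring is not a division ring, so it falls under the boolean
      alternative.\<close>
    case True
    then have "a \<otimes> a \<ominus> a \<in> nilpotents R" if "a \<in> carrier R" for a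
      using that zero_nilpotent one_zeroD by (auto simp: minus_eq)
    then show ?thesis using boolean_ring_quotient_iff[OF nilpotents_ideal] by simp
  next
    case False
    then show ?thesis
      using skew_field_quotient_nilpotents_iff[OF nilpotents_ideal] local by blast
  qed
qed

end

section \<open>The two directions of the characterization\<close>

theorem proposition2p20:
  fixes R :: "('a, 'm) ring_scheme" (structure)
  assumes "ring R"
  shows "gunc_ring R \<longleftrightarrow>
    ideal (nilpotents R) R \<and>
    (boolean_ring (R Quot nilpotents R) \<or> skew_field (R Quot nilpotents R)) \<and>
    abelian_ring R"
proof (intro iffI conjI)
  assume "gunc_ring R"
  then interpret gunc_ring R .
  show "ideal (nilpotents R) R" by (rule nilpotents_ideal)
  show "boolean_ring (R Quot nilpotents R) \<or> skew_field (R Quot nilpotents R)"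
    by (rule quotient_boolean_or_skew)
  show "abelian_ring R" by (rule abelian_ring_axioms)
next
  assume R: "ideal (nilpotents R) R \<and>
    (boolean_ring (R Quot nilpotents R) \<or> skew_field (R Quot nilpotents R)) \<and>
    abelian_ring R"
  then interpret abelian_ring R by simp
  interpret ideal "nilpotents R" R using R by simp
  show "gunc_ring R"
  proof
    fix a assume a: "a \<in> carrier R" "a \<notin> Units R"
    have "\<exists>e\<in>idempotents R. a \<ominus> e \<in> nilpotents R"
    \<comment> \<open>In the boolean case every element, unit or not, lifts to an idempotent; in the
      division ring case a nonunit is nilpotent and \<open>e = 0\<close> works.\<close>
    proof (cases "boolean_ring (R Quot nilpotents R)")
      case True
      then show ?thesis
        using idempotent_lift[OF is_ideal _ a(1)] boolean_ring_quotient_iff[OF is_ideal] by blast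
    next
      case False
      then have "a \<in> nilpotents R"
        using R a skew_field_quotient_nilpotents_iff[OF is_ideal] by blast
      then show ?thesis
        using a by (intro bexI[of _ \<zero>]) (auto simp: minus_eq intro: idempotentsI)
    qed
    moreover have "e = f" if e: "e \<in> idempotents R" "a \<ominus> e \<in> nilpotents R"
      and f: "f \<in> idempotents R" "a \<ominus> f \<in> nilpotents R" for e f
    proof (rule idempotent_eqI[OF is_ideal e(1) f(1)])
      have "e \<ominus> f = (a \<ominus> f) \<oplus> \<ominus> (a \<ominus> e)"
        using a(1) idempotents_carrier[OF e(1)] idempotents_carrier[OF f(1)] by algebra
      then show "e \<ominus> f \<in> nilpotents R" using e f by simp
    qed
    ultimately show "uniquely_nil_clean R a" unfolding uniquely_nil_clean_def by blast
  qed
qed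

end
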